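(* Let $m,n,m',n'\ge 1$ and $k$ be integers with $1\le k\le m'+n'-1$ (i.e. $Q=(m,n,m',n';k)$ is a nontrivial quintuple). Then $Q$ is realizable if and only if both of the following conditions hold: (R1) $m'-1\le mk$; (R2) $n'$ divides $nk$.
   Context: For integers $m,n\ge 1$, $C_{m,n}$ denotes the finite cyclic (i.e. generated by one element) semigroup of index $m$ and period $n$: it is $\langle a\rangle=\{a,a^2,\ldots,a^{m+n-1}\}$ with $m+n-1$ distinct elements and $a^{m+n}=a^m$. A quintuple is $Q=(m,n,m',n';k)$ with integers $m,n,m',n'\ge 1$ and $k\in\{0,1,\ldots,m'+n'-1\}$; it is nontrivial if $k\ge 1$. The quintuple $Q$ is realizable if there is a commutative semigroup $\langle a,b\rangle$ generated by two elements $a,b$ such that: $\langle a,b\rangle$ is the disjoint union of its subsemigroups $\langle a\rangle$ and $\langle b\rangle$; $\langle a\rangle\simeq C_{m,n}$; $\langle b\rangle\simeq C_{m',n'}$; and $ab=b^{k+1}$. *)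

theory Defs
  imports "HOL-Algebra.Group"
begin

text \<open>
  Semigroups are represented by the record type \<open>monoid\<close>, so that \<open>hom\<close>, \<open>iso\<close> and \<open>\<cong>\<close> are
  available. These refer to the fields \<open>carrier\<close> and \<open>mult\<close> only, and the field \<open>one\<close> plays no
  role anywhere below.
\<close>

definition comm_semigroup :: "('a, 'b) monoid_scheme \<Rightarrow> bool" where
  "comm_semigroup G \<longleftrightarrow>
     (\<forall>x\<in>carrier G. \<forall>y\<in>carrier G. x \<otimes>\<^bsub>G\<^esub> y \<in> carrier G) \<and>
     (\<forall>x\<in>carrier G. \<forall>y\<in>carrier G. \<forall>z\<in>carrier G.
        (x \<otimes>\<^bsub>G\<^esub> y) \<otimes>\<^bsub>G\<^esub> z = x \<otimes>\<^bsub>G\<^esub> (y \<otimes>\<^bsub>G\<^esub> z)) \<and>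
     (\<forall>x\<in>carrier G. \<forall>y\<in>carrier G. x \<otimes>\<^bsub>G\<^esub> y = y \<otimes>\<^bsub>G\<^esub> x)"

inductive_set sgen :: "('a, 'b) monoid_scheme \<Rightarrow> 'a set \<Rightarrow> 'a set" for G A where
  incl: "x \<in> A \<Longrightarrow> x \<in> sgen G A"
| mult: "x \<in> sgen G A \<Longrightarrow> y \<in> sgen G A \<Longrightarrow> x \<otimes>\<^bsub>G\<^esub> y \<in> sgen G A"

abbreviation subsemigroup_generated ::
    "('a, 'b) monoid_scheme \<Rightarrow> 'a set \<Rightarrow> ('a, 'b) monoid_scheme" where
  "subsemigroup_generated G A \<equiv> G\<lparr>carrier := sgen G A\<rparr>"

text \<open>Semigroup powers; only exponents \<open>n \<ge> 1\<close> are meaningful (\<open>x\<^sup>0\<close> is the junk value \<open>x\<close>).\<close>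

definition spow :: "('a, 'b) monoid_scheme \<Rightarrow> 'a \<Rightarrow> nat \<Rightarrow> 'a" where
  "spow G x n = ((\<lambda>y. x \<otimes>\<^bsub>G\<^esub> y) ^^ (n - 1)) x"

text \<open>
  The cyclic semigroup of index \<open>m \<ge> 1\<close> and period \<open>n \<ge> 1\<close>: the number \<open>i\<close> stands for the
  power \<open>a\<^sup>i\<close> of the generator, and exponents from \<open>m\<close> on are reduced modulo \<open>n\<close> into the
  interval from \<open>m\<close> to \<open>m + n - 1\<close>.
\<close>

definition cyc_reduce :: "nat \<Rightarrow> nat \<Rightarrow> nat \<Rightarrow> nat" where
  "cyc_reduce m n e = (if e < m then e else m + (e - m) mod n)"

definition cyclic_semigroup :: "nat \<Rightarrow> nat \<Rightarrow> nat monoid" where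
  "cyclic_semigroup m n =
     \<lparr>carrier = {1..m + n - 1}, mult = (\<lambda>i j. cyc_reduce m n (i + j)), one = undefined\<rparr>"

definition realizes ::
    "('a, 'b) monoid_scheme \<Rightarrow> 'a \<Rightarrow> 'a \<Rightarrow> nat \<Rightarrow> nat \<Rightarrow> nat \<Rightarrow> nat \<Rightarrow> nat \<Rightarrow> bool" where
  "realizes G a b m n m' n' k \<longleftrightarrow>
     comm_semigroup G \<and> a \<in> carrier G \<and> b \<in> carrier G \<and>
     carrier G = sgen G {a, b} \<and>
     carrier G = sgen G {a} \<union> sgen G {b} \<and> sgen G {a} \<inter> sgen G {b} = {} \<and>
     subsemigroup_generated G {a} \<cong> cyclic_semigroup m n \<and>
     subsemigroup_generated G {b} \<cong> cyclic_semigroup m' n' \<and>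
     a \<otimes>\<^bsub>G\<^esub> b = spow G b (k + 1)"

text \<open>
  HOL cannot quantify existentially over types. A semigroup realizing a quintuple is finite, so
  carriers within \<open>nat\<close> suffice: see \<open>realizes_imp_realizable\<close> below.
\<close>

definition realizable :: "nat \<Rightarrow> nat \<Rightarrow> nat \<Rightarrow> nat \<Rightarrow> nat \<Rightarrow> bool" where
  "realizable m n m' n' k \<longleftrightarrow> (\<exists>(G :: nat monoid) a b. realizes G a b m n m' n' k)"


lemma comm_semigroupD:
  assumes "comm_semigroup G" "x \<in> carrier G" "y \<in> carrier G"
  shows "x \<otimes>\<^bsub>G\<^esub> y \<in> carrier G" "x \<otimes>\<^bsub>G\<^esub> y = y \<otimes>\<^bsub>G\<^esub> x"
    and "z \<in> carrier G \<Longrightarrow> (x \<otimes>\<^bsub>G\<^esub> y) \<otimes>\<^bsub>G\<^esub> z = x \<otimes>\<^bsub>G\<^esub> (y \<otimes>\<^bsub>G\<^esub> z)"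
  using assms unfolding comm_semigroup_def by blast+

lemma sgen_subset_carrier:
  assumes "comm_semigroup G" "A \<subseteq> carrier G"
  shows "sgen G A \<subseteq> carrier G"
proof
  fix x assume "x \<in> sgen G A"
  then show "x \<in> carrier G"
  proof induction
    case (incl x)
    then show ?case using assms(2) by blast
  next
    case (mult x y)
    then show ?case by (intro comm_semigroupD(1)[OF assms(1)])
  qed
qed

lemma spow_1 [simp]: "spow G x (Suc 0) = x"
  by (simp add: spow_def)

lemma spow_Suc: "n \<ge> 1 \<Longrightarrow> spow G x (Suc n) = x \<otimes>\<^bsub>G\<^esub> spow G x n"
  by (cases n) (simp_all add: spow_def)

lemma spow_closed:
  assumes "comm_semigroup G" "x \<in> carrier G" "n \<ge> 1"
  shows "spow G x n \<in> carrier G"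
  using assms(3)
  by (induction n rule: nat_induct_at_least)
     (simp_all add: assms(2) spow_Suc comm_semigroupD(1)[OF assms(1)])


context
  fixes m n :: nat
  assumes pos: "m \<ge> 1" "n \<ge> 1"
begin

lemma cyc_reduce_less: "cyc_reduce m n e < m + n"
  using pos by (auto simp: cyc_reduce_def)

lemma cyc_reduce_ge_1: "e \<ge> 1 \<Longrightarrow> cyc_reduce m n e \<ge> 1"
  using pos by (auto simp: cyc_reduce_def)

lemma cyc_reduce_add: "cyc_reduce m n (cyc_reduce m n e + f) = cyc_reduce m n (e + f)"
proof (cases "e < m")
  case True
  then show ?thesis by (simp add: cyc_reduce_def)
next
  case False
  have "((e - m) mod n + f) mod n = (e + f - m) mod n"
    using False by (simp add: mod_add_left_eq)
  with False show ?thesis by (simp add: cyc_reduce_def)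
qed

lemma cyc_reduce_add': "cyc_reduce m n (f + cyc_reduce m n e) = cyc_reduce m n (f + e)"
  using cyc_reduce_add[of e f] by (simp add: add.commute)

lemma cyc_reduce_id: "e < m + n \<Longrightarrow> cyc_reduce m n e = e"
  by (auto simp: cyc_reduce_def)

lemma comm_semigroup_cyclic: "comm_semigroup (cyclic_semigroup m n)"
proof -
  have "cyc_reduce m n (x + y) \<in> {1..m + n - 1}" if "x \<ge> 1" for x y
    using cyc_reduce_less[of "x + y"] cyc_reduce_ge_1[of "x + y"] that by auto
  moreover have "cyc_reduce m n (cyc_reduce m n (x + y) + z) =
      cyc_reduce m n (x + cyc_reduce m n (y + z))" for x y z
    by (simp only: cyc_reduce_add cyc_reduce_add' add.assoc)
  moreover have "cyc_reduce m n (x + y) = cyc_reduce m n (y + x)" for x y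
    by (simp only: add.commute)
  ultimately show ?thesis
    unfolding comm_semigroup_def cyclic_semigroup_def by simp
qed

lemma spow_cyclic: "e \<ge> 1 \<Longrightarrow> spow (cyclic_semigroup m n) 1 e = cyc_reduce m n e"
proof (induction e rule: nat_induct_at_least)
  case base
  have "cyc_reduce m n 1 = 1" using pos by (intro cyc_reduce_id) auto
  then show ?case by simp
next
  case (Suc e)
  then show ?case
    using cyc_reduce_add'[of 1 e] by (simp add: spow_Suc) (simp add: cyclic_semigroup_def)
qed

lemma cyclic_generated: "sgen (cyclic_semigroup m n) {1} = carrier (cyclic_semigroup m n)"
proof
  have "1 \<in> carrier (cyclic_semigroup m n)" using pos by (simp add: cyclic_semigroup_def)
  then show "sgen (cyclic_semigroup m n) {1} \<subseteq> carrier (cyclic_semigroup m n)"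
    by (intro sgen_subset_carrier comm_semigroup_cyclic) auto
  have *: "spow (cyclic_semigroup m n) 1 e \<in> sgen (cyclic_semigroup m n) {1}" if "e \<ge> 1" for e
    using that
    by (induction e rule: nat_induct_at_least) (auto simp: spow_Suc intro: sgen.intros)
  show "carrier (cyclic_semigroup m n) \<subseteq> sgen (cyclic_semigroup m n) {1}"
  proof
    fix e assume "e \<in> carrier (cyclic_semigroup m n)"
    then have "e \<ge> 1" "e < m + n" using pos by (auto simp: cyclic_semigroup_def)
    then show "e \<in> sgen (cyclic_semigroup m n) {1}"
      using *[of e] spow_cyclic[of e] cyc_reduce_id[of e] by simp
  qed
qed

lemma cyclic_index_period:
  "inj_on (spow (cyclic_semigroup m n) 1) {1..m + n - 1}"
  "carrier (cyclic_semigroup m n) = spow (cyclic_semigroup m n) 1 ` {1..m + n - 1}"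
  "spow (cyclic_semigroup m n) 1 (m + n) = spow (cyclic_semigroup m n) 1 m"
proof -
  have *: "spow (cyclic_semigroup m n) 1 e = e" if "e \<in> {1..m + n - 1}" for e
  proof -
    have "e \<ge> 1" "e < m + n" using that pos by auto
    then show ?thesis by (simp only: spow_cyclic cyc_reduce_id)
  qed
  show "inj_on (spow (cyclic_semigroup m n) 1) {1..m + n - 1}"
    by (intro inj_onI) (simp only: *)
  show "carrier (cyclic_semigroup m n) = spow (cyclic_semigroup m n) 1 ` {1..m + n - 1}"
  proof -
    have "spow (cyclic_semigroup m n) 1 ` {1..m + n - 1} = (\<lambda>e. e) ` {1..m + n - 1}"
      by (rule image_cong[OF refl *])
    then show ?thesis by (simp add: cyclic_semigroup_def)
  qed
  have "cyc_reduce m n (m + n) = cyc_reduce m n m" by (simp add: cyc_reduce_def)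
  moreover have "m + n \<ge> 1" using pos by simp
  ultimately show "spow (cyclic_semigroup m n) 1 (m + n) = spow (cyclic_semigroup m n) 1 m"
    using pos by (simp only: spow_cyclic)
qed

end


lemma sgen_iso_image:
  assumes G: "comm_semigroup G" and h: "h \<in> iso G H" and A: "A \<subseteq> carrier G"
  shows "sgen H (h ` A) = h ` sgen G A"
proof
  have hm: "h (x \<otimes>\<^bsub>G\<^esub> y) = h x \<otimes>\<^bsub>H\<^esub> h y" if "x \<in> carrier G" "y \<in> carrier G" for x y
    using h that by (auto simp: iso_def hom_def)
  note sub = sgen_subset_carrier[OF G A]
  show "sgen H (h ` A) \<subseteq> h ` sgen G A"
  proof
    fix y assume "y \<in> sgen H (h ` A)"
    then show "y \<in> h ` sgen G A"
    proof induction
      case (incl y)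
      then show ?case by (auto intro: sgen.incl)
    next
      case (mult x y)
      then obtain u v where uv: "u \<in> sgen G A" "v \<in> sgen G A" "x = h u" "y = h v" by blast
      have "x \<otimes>\<^bsub>H\<^esub> y = h (u \<otimes>\<^bsub>G\<^esub> v)" using uv sub by (simp add: hm subset_iff)
      then show ?case using uv by (auto intro: sgen.mult)
    qed
  qed
  have "h x \<in> sgen H (h ` A)" if "x \<in> sgen G A" for x
    using that
  proof induction
    case (incl x)
    then show ?case by (auto intro: sgen.incl)
  next
    case (mult x y)
    then show ?case using sub by (auto simp: hm subset_iff intro: sgen.mult)
  qed
  then show "h ` sgen G A \<subseteq> sgen H (h ` A)" by blast
qed

lemma spow_iso:
  assumes G: "comm_semigroup G" and h: "h \<in> iso G H" and x: "x \<in> carrier G" and "n \<ge> 1"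
  shows "h (spow G x n) = spow H (h x) n"
  using \<open>n \<ge> 1\<close>
proof (induction n rule: nat_induct_at_least)
  case base
  then show ?case by simp
next
  case (Suc n)
  then show ?case
    using h x spow_closed[OF G x \<open>1 \<le> n\<close>] by (auto simp: spow_Suc iso_def hom_def)
qed

lemma realizes_iso:
  assumes G: "realizes G a b m n m' n' k" and h: "h \<in> iso G H"
  shows "realizes H (h a) (h b) m n m' n' k"
proof -
  note D = G[unfolded realizes_def]
  have sg: "comm_semigroup G" and ab: "a \<in> carrier G" "b \<in> carrier G"
    using D by blast+
  have inj: "inj_on h (carrier G)" and im: "carrier H = h ` carrier G"
    using h by (auto simp: iso_def bij_betw_def)
  have hm: "h x \<otimes>\<^bsub>H\<^esub> h y = h (x \<otimes>\<^bsub>G\<^esub> y)" if "x \<in> carrier G" "y \<in> carrier G" for x y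
    using h that by (auto simp: iso_def hom_def)
  note cl = comm_semigroupD[OF sg]
  have sgH: "comm_semigroup H"
    unfolding comm_semigroup_def im by (auto simp: hm cl(1,3)) (simp add: cl(2))
  have gen: "sgen H (h ` A) = h ` sgen G A" if "A \<subseteq> carrier G" for A
    using sgen_iso_image[OF sg h that] .
  have gen1: "sgen H {h x} = h ` sgen G {x}" if "x \<in> carrier G" for x
    using gen[of "{x}"] that by simp
  have gen2: "sgen H {h a, h b} = h ` sgen G {a, b}"
    using gen[of "{a, b}"] ab by simp
  have cyc: "subsemigroup_generated H {h x} \<cong> C"
    if x: "x \<in> carrier G" and C: "subsemigroup_generated G {x} \<cong> C" for x and C :: "nat monoid"
  proof -
    obtain g where g: "g \<in> hom (subsemigroup_generated G {x}) C"
        "bij_betw g (sgen G {x}) (carrier C)"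
      using C by (auto simp: is_iso_def iso_def)
    define f where "f = the_inv_into (sgen G {x}) h"
    have sub: "sgen G {x} \<subseteq> carrier G"
      using sgen_subset_carrier[OF sg] x by simp
    then have injx: "inj_on h (sgen G {x})" using inj inj_on_subset by blast
    have f: "f (h y) = y" if "y \<in> sgen G {x}" for y
      unfolding f_def using the_inv_into_f_f[OF injx that] .
    have "bij_betw f (sgen H {h x}) (sgen G {x})"
      unfolding f_def gen1[OF x]
      by (intro bij_betw_the_inv_into) (use injx in \<open>simp add: bij_betw_def\<close>)
    then have "bij_betw (g \<circ> f) (sgen H {h x}) (carrier C)"
      using g(2) bij_betw_trans by blast
    moreover have "g \<circ> f \<in> hom (subsemigroup_generated H {h x}) C"
    proof (rule homI)
      fix y assume "y \<in> carrier (subsemigroup_generated H {h x})"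
      then show "(g \<circ> f) y \<in> carrier C"
        using \<open>bij_betw (g \<circ> f) _ _\<close> by (auto dest: bij_betwE)
    next
      fix y z
      assume "y \<in> carrier (subsemigroup_generated H {h x})"
        "z \<in> carrier (subsemigroup_generated H {h x})"
      then obtain u v where uv: "u \<in> sgen G {x}" "v \<in> sgen G {x}" "y = h u" "z = h v"
        by (auto simp: gen1[OF x])
      then have "f (y \<otimes>\<^bsub>H\<^esub> z) = u \<otimes>\<^bsub>G\<^esub> v"
        using sub by (auto simp: hm subset_iff intro!: f sgen.mult)
      then show "(g \<circ> f) (y \<otimes>\<^bsub>subsemigroup_generated H {h x}\<^esub> z) = (g \<circ> f) y \<otimes>\<^bsub>C\<^esub> (g \<circ> f) z"
        using uv g(1) by (auto simp: f hom_def)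
    qed
    ultimately show ?thesis
      by (intro is_isoI[of "g \<circ> f"]) (simp add: iso_def)
  qed
  have "h ` sgen G {a} \<inter> h ` sgen G {b} = h ` (sgen G {a} \<inter> sgen G {b})"
    using sgen_subset_carrier[OF sg] ab by (intro inj_on_image_Int[OF inj, symmetric]) auto
  then have "sgen H {h a} \<inter> sgen H {h b} = {}"
    using D gen1 ab by simp
  moreover have "carrier H = sgen H {h a, h b}"
    using D by (simp only: im gen2)
  moreover have "carrier H = sgen H {h a} \<union> sgen H {h b}"
  proof -
    have "carrier G = sgen G {a} \<union> sgen G {b}" using D by blast
    then show ?thesis unfolding im gen1[OF ab(1)] gen1[OF ab(2)] image_Un[symmetric] by (rule arg_cong)
  qed
  moreover have "h a \<otimes>\<^bsub>H\<^esub> h b = spow H (h b) (k + 1)"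
    using D hm[OF ab] spow_iso[OF sg h ab(2), of "k + 1"] by simp
  ultimately show ?thesis
    unfolding realizes_def using sgH ab im cyc D by blast
qed

theorem realizes_imp_realizable:
  fixes G :: "('a, 'b) monoid_scheme"
  assumes G: "realizes G a b m n m' n' k"
  shows "realizable m n m' n' k"
proof -
  note D = G[unfolded realizes_def]
  have "finite (sgen G {a})" "finite (sgen G {b})"
    using D iso_finite[of "subsemigroup_generated G {a}" "cyclic_semigroup m n"]
      iso_finite[of "subsemigroup_generated G {b}" "cyclic_semigroup m' n'"]
    by (simp_all add: cyclic_semigroup_def)
  then have "finite (carrier G)" using D by (metis finite_UnI)
  then obtain h :: "'a \<Rightarrow> nat" where inj: "inj_on h (carrier G)"
    using finite_imp_inj_to_nat_seg by metis
  define f where "f = the_inv_into (carrier G) h"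
  define H :: "nat monoid" where
    "H = \<lparr>carrier = h ` carrier G, mult = (\<lambda>x y. h (f x \<otimes>\<^bsub>G\<^esub> f y)), one = undefined\<rparr>"
  have "f (h x) = x" if "x \<in> carrier G" for x
    unfolding f_def using the_inv_into_f_f[OF inj that] .
  then have "h \<in> iso G H"
    using inj by (auto simp: iso_def hom_def H_def bij_betw_def)
  from realizes_iso[OF G this] show ?thesis
    unfolding realizable_def by blast
qed

end

theory Submission
  imports Defs
begin

text \<open>
  Write \<open>[e]\<close> for \<open>cyc_reduce m n e\<close> and \<open>[e]'\<close> for \<open>cyc_reduce m' n' e\<close>. The relation
  \<open>ab = b\<^sup>k\<^sup>+\<^sup>1\<close> and commutativity force \<open>a\<^sup>i b\<^sup>j = b\<^sup>i\<^sup>k\<^sup>+\<^sup>j\<close>, so the multiplication is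
  determined by the quintuple, and the only question is whether this rule is compatible with
  \<open>a\<^sup>m = a\<^sup>m\<^sup>+\<^sup>n\<close>. Multiplying this relation by \<open>b\<close> gives \<open>b\<^sup>m\<^sup>k\<^sup>+\<^sup>1 = b\<^sup>m\<^sup>k\<^sup>+\<^sup>1\<^sup>+\<^sup>n\<^sup>k\<close>. Two
  different exponents of \<open>b\<close> name the same element iff both are at least \<open>m'\<close> and they are
  congruent modulo \<open>n'\<close>; since \<open>nk > 0\<close>, this says \<open>m' \<le> mk + 1\<close> and \<open>n'\<close> divides \<open>nk\<close>.

  Conversely, under these two conditions \<open>[[e] k + j]' = [e k + j]'\<close> for all \<open>j \<ge> 1\<close>
  (\<open>cyc_reduce_reduced_times\<close>). Hence the rule is well defined on the disjoint union of the two
  cyclic semigroups, and both bracketings of any triple product reduce the same sum of exponents.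

  One point needs care: an isomorphism from \<open>\<langle>b\<rangle>\<close> to the standard cyclic semigroup need not
  send \<open>b\<close> to \<open>1\<close>, because for index 1 this is a cyclic group with several generators.
  The lemma \<open>spow_eq_iff\<close> shows that the coincidences among the powers are the same for
  every generator.
\<close>


section \<open>Reduction of exponents\<close>

lemma cyc_reduce_eq_iff:
  assumes "m \<ge> 1" "n \<ge> 1"
  shows "cyc_reduce m n e = cyc_reduce m n (e + d) \<longleftrightarrow> d = 0 \<or> m \<le> e \<and> n dvd d"
proof (cases "e < m")
  case True
  then show ?thesis by (auto simp: cyc_reduce_def)
next
  case False
  have "(e - m) mod n = (e - m + d) mod n \<longleftrightarrow> n dvd d"
    using mod_eq_dvd_iff_nat[of "e - m" "e - m + d" n] by (auto simp: eq_commute)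
  then show ?thesis using False by (auto simp: cyc_reduce_def)
qed

lemma cyc_reduce_mult:
  assumes "m \<ge> 1" "n \<ge> 1"
  shows "cyc_reduce m n (cyc_reduce m n e * s) = cyc_reduce m n (e * s)"
proof (induction s)
  case 0
  then show ?case by simp
next
  case (Suc s)
  have "cyc_reduce m n (cyc_reduce m n e * Suc s)
      = cyc_reduce m n (e + cyc_reduce m n (cyc_reduce m n e * s))"
    by (simp add: cyc_reduce_add[OF assms] cyc_reduce_add'[OF assms])
  also have "\<dots> = cyc_reduce m n (e * Suc s)"
    by (simp add: Suc cyc_reduce_add'[OF assms])
  finally show ?case .
qed

text \<open>
  This is where the two conditions enter: reducing \<open>e\<close> changes it only if \<open>e \<ge> m\<close>, and then by
  a multiple of \<open>n\<close>. So \<open>e k + j\<close> changes by a multiple of \<open>n k\<close>, hence of \<open>n'\<close>, while staying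
  at least \<open>m k + 1 \<ge> m'\<close>.
\<close>

lemma cyc_reduce_reduced_times:
  assumes pos: "m \<ge> 1" "n \<ge> 1" "m' \<ge> 1" "n' \<ge> 1" "j \<ge> 1"
    and R1: "m' - 1 \<le> m * k" and R2: "n' dvd n * k"
  shows "cyc_reduce m' n' (cyc_reduce m n e * k + j) = cyc_reduce m' n' (e * k + j)"
proof (cases "e < m")
  case True
  then show ?thesis by (simp add: cyc_reduce_def)
next
  case False
  define r where "r = cyc_reduce m n e"
  define q where "q = (e - m) div n"
  have e: "e = r + q * n" and r: "m \<le> r"
    using False div_mult_mod_eq[of "e - m" n] unfolding r_def q_def cyc_reduce_def by simp_all
  have "m' \<le> r * k + j" using R1 r pos mult_le_mono1[OF r, of k] by linarith
  moreover have "n' dvd q * n * k" using R2 by (simp add: mult.assoc)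
  ultimately have "cyc_reduce m' n' (r * k + j) = cyc_reduce m' n' ((r * k + j) + q * n * k)"
    using cyc_reduce_eq_iff[OF pos(3,4)] by blast
  then show ?thesis unfolding r_def[symmetric] by (simp add: e algebra_simps)
qed


section \<open>Powers and generators\<close>

lemma spow_add:
  assumes G: "comm_semigroup G" "x \<in> carrier G" and "i \<ge> 1" "j \<ge> 1"
  shows "spow G x (i + j) = spow G x i \<otimes>\<^bsub>G\<^esub> spow G x j"
  using \<open>i \<ge> 1\<close>
proof (induction i rule: nat_induct_at_least)
  case base
  then show ?case using \<open>j \<ge> 1\<close> by (simp add: spow_Suc)
next
  case (Suc i)
  then show ?case
    using G \<open>j \<ge> 1\<close> spow_closed[OF G] by (simp add: spow_Suc comm_semigroupD(3)[OF G(1)])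
qed

lemma sgen_carrier_update [simp]: "sgen (G\<lparr>carrier := S\<rparr>) A = sgen G A"
proof -
  have "x \<in> sgen G A" if "x \<in> sgen (G\<lparr>carrier := S\<rparr>) A" for x
    using that by induction (auto intro: sgen.intros)
  moreover have "x \<in> sgen (G\<lparr>carrier := S\<rparr>) A" if "x \<in> sgen G A" for x
    using that
  proof induction
    case (mult x y)
    then show ?case using sgen.mult[of x "G\<lparr>carrier := S\<rparr>" A y] by simp
  qed (rule sgen.incl)
  ultimately show ?thesis by blast
qed

lemma spow_carrier_update [simp]: "spow (G\<lparr>carrier := S\<rparr>) x n = spow G x n"
  by (simp add: spow_def)

lemma sgen_mono: "A \<subseteq> B \<Longrightarrow> sgen G A \<subseteq> sgen G B"
proof
  fix x assume "A \<subseteq> B" "x \<in> sgen G A"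
  from this(2) show "x \<in> sgen G B"
    by induction (use \<open>A \<subseteq> B\<close> in \<open>auto intro: sgen.intros\<close>)
qed

lemma comm_semigroup_subsemigroup_generated:
  assumes G: "comm_semigroup G" and A: "A \<subseteq> carrier G"
  shows "comm_semigroup (subsemigroup_generated G A)"
proof -
  have sub: "x \<in> carrier G" if "x \<in> sgen G A" for x
    using sgen_subset_carrier[OF G A] that by blast
  show ?thesis
    unfolding comm_semigroup_def
    by (simp add: sgen.mult) (metis comm_semigroupD(2,3)[OF G] sub)
qed

lemma spow_cyclic_semigroup:
  assumes pos: "m \<ge> 1" "n \<ge> 1" and "e < m + n" and "i \<ge> 1"
  shows "spow (cyclic_semigroup m n) e i = cyc_reduce m n (e * i)"
  using \<open>i \<ge> 1\<close>
proof (induction i rule: nat_induct_at_least)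
  case base
  then show ?case using cyc_reduce_id[OF pos \<open>e < m + n\<close>] by simp
next
  case (Suc i)
  then show ?case
    using cyc_reduce_add'[OF pos, of e "e * i"] by (simp add: spow_Suc) (simp add: cyclic_semigroup_def)
qed

text \<open>
  The elements that \<open>e\<close> generates are the multiples of \<open>e\<close>, so a generator \<open>e\<close> has a
  multiplicative inverse \<open>s\<close> in the sense that \<open>e s\<close> reduces to \<open>1\<close>.
\<close>

lemma cyclic_generator_inverse:
  assumes pos: "m \<ge> 1" "n \<ge> 1" and e: "e < m + n"
    and gen: "1 \<in> sgen (cyclic_semigroup m n) {e}"
  obtains s where "cyc_reduce m n (e * s) = 1"
proof -
  have "\<exists>s. x = cyc_reduce m n (e * s)" if "x \<in> sgen (cyclic_semigroup m n) {e}" for x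
    using that
  proof induction
    case (incl x)
    then show ?case using cyc_reduce_id[OF pos e] by (intro exI[of _ 1]) simp
  next
    case (mult x y)
    then obtain s t where st: "x = cyc_reduce m n (e * s)" "y = cyc_reduce m n (e * t)" by blast
    have "cyc_reduce m n (x + y) = cyc_reduce m n (e * (s + t))"
      unfolding st cyc_reduce_add[OF pos] cyc_reduce_add'[OF pos] by (simp add: algebra_simps)
    then show ?case by (auto simp: cyclic_semigroup_def)
  qed
  from this[OF gen] that show ?thesis by metis
qed

text \<open>
  Let \<open>x\<close> correspond to the residue \<open>e\<close>, and let \<open>e s\<close> reduce to \<open>1\<close>. If \<open>e i\<close> and \<open>e j\<close>
  have the same reduction, then so have \<open>e i s\<close> and \<open>e j s\<close>, that is, \<open>i\<close> and \<open>j\<close>.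
\<close>

lemma spow_eq_iff:
  assumes G: "comm_semigroup G" and x: "x \<in> carrier G"
    and pos: "m \<ge> 1" "n \<ge> 1" "i \<ge> 1" "j \<ge> 1"
    and iso: "subsemigroup_generated G {x} \<cong> cyclic_semigroup m n"
  shows "spow G x i = spow G x j \<longleftrightarrow> cyc_reduce m n i = cyc_reduce m n j"
proof -
  let ?S = "subsemigroup_generated G {x}" and ?C = "cyclic_semigroup m n"
  obtain f where f: "f \<in> iso ?S ?C" using iso by (auto simp: is_iso_def)
  have S: "comm_semigroup ?S"
    using comm_semigroup_subsemigroup_generated[OF G] x by simp
  have xS: "x \<in> carrier ?S" by (simp add: sgen.incl)
  have bij: "bij_betw f (carrier ?S) (carrier ?C)" using f by (simp add: iso_def)
  define e where "e = f x"
  have e: "e < m + n"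
    using bij_betwE[OF bij] xS pos unfolding e_def cyclic_semigroup_def by fastforce
  have "sgen ?C {e} = carrier ?C"
    using sgen_iso_image[OF S f, of "{x}"] xS bij unfolding e_def by (simp add: bij_betw_def)
  then have "1 \<in> sgen ?C {e}" using pos by (simp add: cyclic_semigroup_def)
  then obtain s where s: "cyc_reduce m n (e * s) = 1"
    using cyclic_generator_inverse[OF pos(1,2) e] by blast
  \<comment> \<open>Multiplication of exponents by \<open>s\<close> undoes multiplication by \<open>e\<close>.\<close>
  have inv: "cyc_reduce m n (cyc_reduce m n (e * l) * s) = cyc_reduce m n l" for l
    using cyc_reduce_mult[OF pos(1,2), of "e * l" s] cyc_reduce_mult[OF pos(1,2), of "e * s" l] s
    by (simp add: ac_simps)
  have scale: "cyc_reduce m n (cyc_reduce m n l * e) = cyc_reduce m n (e * l)" for l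
    using cyc_reduce_mult[OF pos(1,2)] by (simp add: ac_simps)
  have pow: "f (spow G x l) = cyc_reduce m n (e * l)" if "l \<ge> 1" for l
    using spow_iso[OF S f xS that] spow_cyclic_semigroup[OF pos(1,2) e that] by (simp add: e_def)
  have cl: "spow G x l \<in> carrier ?S" if "l \<ge> 1" for l
    using spow_closed[OF S xS that] by simp
  have "spow G x i = spow G x j \<longleftrightarrow> f (spow G x i) = f (spow G x j)"
    using bij cl pos(3,4) by (auto simp: bij_betw_def inj_on_def)
  also have "\<dots> \<longleftrightarrow> cyc_reduce m n (e * i) = cyc_reduce m n (e * j)"
    by (simp only: pow pos(3,4))
  also have "\<dots> \<longleftrightarrow> cyc_reduce m n i = cyc_reduce m n j"
    by (metis inv scale)
  finally show ?thesis .
qed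


section \<open>Necessity\<close>

lemma spow_times_spow:
  assumes G: "comm_semigroup G" "a \<in> carrier G" "b \<in> carrier G"
    and ab: "a \<otimes>\<^bsub>G\<^esub> b = spow G b (k + 1)"
    and "i \<ge> 1"
  shows "spow G a i \<otimes>\<^bsub>G\<^esub> b = spow G b (i * k + 1)"
proof -
  have a_times: "a \<otimes>\<^bsub>G\<^esub> spow G b j = spow G b (k + j)" if "j \<ge> 1" for j
  proof (cases "j = 1")
    case True
    then show ?thesis using ab by simp
  next
    case False
    with that obtain l where l: "j = Suc l" "l \<ge> 1" by (cases j) auto
    have "a \<otimes>\<^bsub>G\<^esub> spow G b j = (a \<otimes>\<^bsub>G\<^esub> b) \<otimes>\<^bsub>G\<^esub> spow G b l"
      using l G spow_closed[OF G(1,3)] by (simp add: spow_Suc comm_semigroupD(3)[OF G(1)])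
    also have "\<dots> = spow G b (k + j)"
      using spow_add[OF G(1,3), of "k + 1" l] l ab by simp
    finally show ?thesis .
  qed
  show ?thesis using \<open>i \<ge> 1\<close>
  proof (induction i rule: nat_induct_at_least)
    case base
    then show ?case using ab by simp
  next
    case (Suc i)
    have "spow G a (Suc i) \<otimes>\<^bsub>G\<^esub> b = a \<otimes>\<^bsub>G\<^esub> (spow G a i \<otimes>\<^bsub>G\<^esub> b)"
      using Suc.hyps G spow_closed[OF G(1,2)] by (simp add: spow_Suc comm_semigroupD(3)[OF G(1)])
    also have "\<dots> = spow G b (Suc i * k + 1)"
      using a_times[of "i * k + 1"] by (simp add: Suc.IH)
    finally show ?case .
  qed
qed

text \<open>Both conditions are read off from \<open>a\<^sup>m b = a\<^sup>m\<^sup>+\<^sup>n b\<close>, written as an equation of powers of \<open>b\<close>.\<close>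

lemma realizes_imp_conditions:
  assumes real: "realizes G a b m n m' n' k"
    and pos: "m \<ge> 1" "n \<ge> 1" "m' \<ge> 1" "n' \<ge> 1" "k \<ge> 1"
  shows "m' - 1 \<le> m * k \<and> n' dvd n * k"
proof -
  note D = real[unfolded realizes_def]
  have G: "comm_semigroup G" "a \<in> carrier G" "b \<in> carrier G"
    and ab: "a \<otimes>\<^bsub>G\<^esub> b = spow G b (k + 1)"
    and isos: "subsemigroup_generated G {a} \<cong> cyclic_semigroup m n"
      "subsemigroup_generated G {b} \<cong> cyclic_semigroup m' n'"
    using D by blast+
  have "spow G a m = spow G a (m + n)"
    using spow_eq_iff[OF G(1,2) pos(1,2) _ _ isos(1), of m "m + n"] pos
      cyc_reduce_eq_iff[OF pos(1,2), of m n] by simp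
  then have "spow G b (m * k + 1) = spow G b ((m + n) * k + 1)"
    using spow_times_spow[OF G ab, of m] spow_times_spow[OF G ab, of "m + n"] pos by simp
  then have "cyc_reduce m' n' (m * k + 1) = cyc_reduce m' n' ((m * k + 1) + n * k)"
    using spow_eq_iff[OF G(1,3) pos(3,4) _ _ isos(2), of "m * k + 1" "(m + n) * k + 1"]
    by (simp add: algebra_simps)
  then show ?thesis
    using cyc_reduce_eq_iff[OF pos(3,4), of "m * k + 1" "n * k"] pos by auto
qed


section \<open>Sufficiency\<close>

text \<open>
  Each of the two standard cyclic semigroups embeds into the semigroup constructed below. The
  subsemigroup structure and the powers there are the transported ones, since an embedding is an
  isomorphism onto its image and both notions depend on the multiplication only.
\<close>

lemma embedded_subsemigroup:
  assumes C: "comm_semigroup C" and x: "x \<in> carrier C" and gen: "sgen C {x} = carrier C"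
    and inj: "inj_on h (carrier C)"
    and hm: "\<And>y z. y \<in> carrier C \<Longrightarrow> z \<in> carrier C \<Longrightarrow> h (y \<otimes>\<^bsub>C\<^esub> z) = h y \<otimes>\<^bsub>G\<^esub> h z"
  shows "sgen G {h x} = h ` carrier C"
    and "subsemigroup_generated G {h x} \<cong> C"
    and "i \<ge> 1 \<Longrightarrow> spow G (h x) i = h (spow C x i)"
proof -
  let ?H = "G\<lparr>carrier := h ` carrier C\<rparr>"
  have h: "h \<in> iso C ?H"
    using inj hm by (auto simp: iso_def hom_def bij_betw_def)
  show gen': "sgen G {h x} = h ` carrier C"
    using sgen_iso_image[OF C h, of "{x}"] x gen by simp
  show "spow G (h x) i = h (spow C x i)" if "i \<ge> 1"
    using spow_iso[OF C h x that] by simp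
  define f where "f = the_inv_into (carrier C) h"
  have f: "f (h y) = y" if "y \<in> carrier C" for y
    unfolding f_def by (rule the_inv_into_f_f[OF inj that])
  have "f \<in> iso (subsemigroup_generated G {h x}) C"
    unfolding iso_def hom_def bij_betw_def gen'
    using comm_semigroupD(1)[OF C] by (auto simp: gen' f hm[symmetric] inj_on_def image_image)
  then show "subsemigroup_generated G {h x} \<cong> C" by (rule is_isoI)
qed

fun glued_mult :: "nat \<Rightarrow> nat \<Rightarrow> nat \<Rightarrow> nat \<Rightarrow> nat \<Rightarrow> nat + nat \<Rightarrow> nat + nat \<Rightarrow> nat + nat" where
  "glued_mult m n m' n' k (Inl i) (Inl j) = Inl (cyc_reduce m n (i + j))"
| "glued_mult m n m' n' k (Inl i) (Inr j) = Inr (cyc_reduce m' n' (i * k + j))"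
| "glued_mult m n m' n' k (Inr i) (Inl j) = Inr (cyc_reduce m' n' (i + j * k))"
| "glued_mult m n m' n' k (Inr i) (Inr j) = Inr (cyc_reduce m' n' (i + j))"

text \<open>The elements \<open>Inl i\<close> and \<open>Inr j\<close> stand for \<open>a\<^sup>i\<close> and \<open>b\<^sup>j\<close>.\<close>

definition glued_semigroup :: "nat \<Rightarrow> nat \<Rightarrow> nat \<Rightarrow> nat \<Rightarrow> nat \<Rightarrow> (nat + nat) monoid" where
  "glued_semigroup m n m' n' k =
     \<lparr>carrier = Inl ` carrier (cyclic_semigroup m n) \<union> Inr ` carrier (cyclic_semigroup m' n'),
      mult = glued_mult m n m' n' k, one = undefined\<rparr>"

lemma comm_semigroup_glued:
  assumes pos: "m \<ge> 1" "n \<ge> 1" "m' \<ge> 1" "n' \<ge> 1"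
    and R: "m' - 1 \<le> m * k" "n' dvd n * k"
  shows "comm_semigroup (glued_semigroup m n m' n' k)"
proof -
  define S where "S = carrier (glued_semigroup m n m' n' k)"
  let ?mul = "glued_mult m n m' n' k"
  have S: "Inl i \<in> S \<longleftrightarrow> i \<ge> 1 \<and> i < m + n" "Inr j \<in> S \<longleftrightarrow> j \<ge> 1 \<and> j < m' + n'" for i j
    using pos by (auto simp: S_def glued_semigroup_def cyclic_semigroup_def)
  note bounds = cyc_reduce_less[OF pos(1,2)] cyc_reduce_ge_1[OF pos(1,2)]
    cyc_reduce_less[OF pos(3,4)] cyc_reduce_ge_1[OF pos(3,4)]
  note red = cyc_reduce_add[OF pos(1,2)] cyc_reduce_add'[OF pos(1,2)]
    cyc_reduce_add[OF pos(3,4)] cyc_reduce_add'[OF pos(3,4)]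
  note mixed = cyc_reduce_reduced_times[OF pos _ R]
  have mixed': "cyc_reduce m' n' (j + cyc_reduce m n e * k) = cyc_reduce m' n' (j + e * k)"
    if "j \<ge> 1" for j e using mixed[OF that, of e] by (simp add: add.commute)
  have "?mul x y \<in> S" if "x \<in> S" "y \<in> S" for x y
    using that
    by (cases x; cases y)
       (simp_all only: glued_mult.simps S bounds trans_le_add1 trans_le_add2 simp_thms)
  \<comment> \<open>An inner reduction disappears by \<open>red\<close>, or by \<open>mixed\<close> where a product of powers of \<open>a\<close>
      meets a power of \<open>b\<close>, whose exponent is at least 1.\<close>
  moreover have "?mul (?mul x y) z = ?mul x (?mul y z)"
    if "x \<in> S" "y \<in> S" "z \<in> S" for x y z
    using that
    by (cases x; cases y; cases z)
       (simp_all only: glued_mult.simps S red mixed mixed' add_mult_distrib add.assoc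
          trans_le_add1 trans_le_add2 simp_thms)
  moreover have "?mul x y = ?mul y x" for x y
    by (cases x; cases y) (simp_all add: add.commute)
  ultimately show ?thesis
    unfolding comm_semigroup_def S_def[symmetric] by (simp add: glued_semigroup_def)
qed

lemma glued_realizes:
  assumes pos: "m \<ge> 1" "n \<ge> 1" "m' \<ge> 1" "n' \<ge> 1"
    and R: "m' - 1 \<le> m * k" "n' dvd n * k"
  shows "realizes (glued_semigroup m n m' n' k) (Inl 1) (Inr 1) m n m' n' k"
proof -
  let ?G = "glued_semigroup m n m' n' k"
  let ?A = "cyclic_semigroup m n" and ?B = "cyclic_semigroup m' n'"
  note G = comm_semigroup_glued[OF pos R]
  have one: "1 \<in> carrier ?A" "1 \<in> carrier ?B"
    using pos by (simp_all add: cyclic_semigroup_def)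
  have hom: "Inl (i \<otimes>\<^bsub>?A\<^esub> j) = Inl i \<otimes>\<^bsub>?G\<^esub> Inl j" "Inr (i \<otimes>\<^bsub>?B\<^esub> j) = Inr i \<otimes>\<^bsub>?G\<^esub> Inr j" for i j
    by (simp_all add: glued_semigroup_def cyclic_semigroup_def)
  note a = embedded_subsemigroup[OF comm_semigroup_cyclic[OF pos(1,2)] one(1)
      cyclic_generated[OF pos(1,2)] inj_Inl hom(1)]
  note b = embedded_subsemigroup[OF comm_semigroup_cyclic[OF pos(3,4)] one(2)
      cyclic_generated[OF pos(3,4)] inj_Inr hom(2)]
  have carrier: "carrier ?G = sgen ?G {Inl 1} \<union> sgen ?G {Inr 1}"
    unfolding a(1) b(1) by (simp add: glued_semigroup_def)
  have ab: "Inl 1 \<in> carrier ?G" "Inr 1 \<in> carrier ?G"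
    unfolding carrier by (auto intro: sgen.incl)
  have "carrier ?G = sgen ?G {Inl 1, Inr 1}"
  proof
    show "carrier ?G \<subseteq> sgen ?G {Inl 1, Inr 1}"
      unfolding carrier by (intro Un_least sgen_mono) auto
    show "sgen ?G {Inl 1, Inr 1} \<subseteq> carrier ?G"
      using ab by (intro sgen_subset_carrier[OF G]) auto
  qed
  moreover have "sgen ?G {Inl 1} \<inter> sgen ?G {Inr 1} = {}"
    unfolding a(1) b(1) by auto
  moreover have "Inl 1 \<otimes>\<^bsub>?G\<^esub> Inr 1 = spow ?G (Inr 1) (k + 1)"
    unfolding b(3)[OF le_add2] spow_cyclic[OF pos(3,4) le_add2]
    by (simp add: glued_semigroup_def)
  ultimately show ?thesis
    unfolding realizes_def using G ab carrier a(2) b(2) by blast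
qed

theorem theorem11:
  fixes m n m' n' k :: nat
  assumes "m \<ge> 1" and "n \<ge> 1" and "m' \<ge> 1" and "n' \<ge> 1"
    and "1 \<le> k" and "k \<le> m' + n' - 1"
  shows "realizable m n m' n' k \<longleftrightarrow> m' - 1 \<le> m * k \<and> n' dvd n * k"
proof
  assume "realizable m n m' n' k"
  then obtain G :: "nat monoid" and a b where "realizes G a b m n m' n' k"
    unfolding realizable_def by (elim exE)
  then show "m' - 1 \<le> m * k \<and> n' dvd n * k"
    by (rule realizes_imp_conditions[OF _ assms(1-5)])
next
  assume R: "m' - 1 \<le> m * k \<and> n' dvd n * k"
  show "realizable m n m' n' k"
    by (rule realizes_imp_realizable[OF glued_realizes[OF assms(1-4) conjunct1[OF R] conjunct2[OF R]]])
qed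

end
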